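(* Let $\ell\ge3$. If $\lambda$ is an $(\ell,0)$-JM partition, then $\lambda$ is a node of the ladder crystal $B(\Lambda_0)^L$.
   Context: $h^\lambda_{(a,b)}$ is the hook length of the box in row $a$, column $b$: the number of boxes of $\lambda$ to the right of and below $(a,b)$ (same row or column), including $(a,b)$. A partition $\lambda$ is an $(\ell,0)$-JM partition if there do not exist boxes $(a,b),(a,y),(x,b)$ in its Young diagram with $\ell\mid h^\lambda_{(a,b)}$, $\ell\nmid h^\lambda_{(a,y)}$ and $\ell\nmid h^\lambda_{(x,b)}$. Ladder crystal. The position $(a,b)$ (row $a$, column $b$) has residue $b-a\bmod\ell$. The ladder of $(a,b)$ is the set of positions $(c,d)$, $c,d\ge1$, with $c-a=(\ell-1)(b-d)$; all its positions have the same residue, and it is an $i$-ladder if that residue is $i$. Ladders are ordered left to right, i.e. by increasing value of $a+(\ell-1)(b-1)$. A box of $\lambda$ of residue $i$ whose removal leaves a partition is a removable $i$-box; a position of residue $i$ not in $\lambda$ whose addition gives a partition is an addable $i$-box. Given a partition $\lambda$ and $0\le i<\ell$, label each addable $i$-box $+$ and each removable $i$-box $-$; the ladder $i$-signature is the word read from leftmost $i$-ladder to rightmost $i$-ladder, and from top to bottom on each ladder. Repeatedly cancel adjacent pairs $-+$ to get the reduced ladder $i$-signature $+\cdots+-\cdots-$. $\widehat f_i\lambda$ is $\lambda$ together with the box of the rightmost remaining $+$ (or $0$ if there is none). The nodes of $B(\Lambda_0)^L$ are the partitions obtained from the empty partition $\emptyset$ by applying finite sequences of the operators $\widehat f_i$,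 $0\le i<\ell$. *)

theory Defs
  imports Main
begin

section \<open>Partitions, hook lengths and JM partitions\<close>

text \<open>A position is a pair \<open>(row, column)\<close>, both counted from \<open>1\<close>; rows grow downwards.
  A partition is identified with its Young diagram, the set of its boxes.  The lemma
  \<open>is_partition_iff_young_diagram\<close> below shows that the sets satisfying \<open>is_partition\<close> are exactly
  the diagrams of weakly decreasing lists of positive integers.\<close>

type_synonym position = "nat \<times> nat"

definition is_partition :: "position set \<Rightarrow> bool" where
  "is_partition \<mu> \<longleftrightarrow> finite \<mu> \<and> (\<forall>(a, b) \<in> \<mu>. 1 \<le> a \<and> 1 \<le> b) \<and>
     (\<forall>(a, b) \<in> \<mu>. \<forall>c d. 1 \<le> c \<and> c \<le> a \<and> 1 \<le> d \<and> d \<le> b \<longrightarrow> (c, d) \<in> \<mu>)"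

definition young_diagram :: "nat list \<Rightarrow> position set" where
  "young_diagram xs = {(a, b). 1 \<le> a \<and> a \<le> length xs \<and> 1 \<le> b \<and> b \<le> xs ! (a - 1)}"

lemma is_partition_pos:
  assumes "is_partition \<mu>" "p \<in> \<mu>"
  shows "1 \<le> fst p \<and> 1 \<le> snd p"
proof -
  have "\<forall>(a, b) \<in> \<mu>. 1 \<le> a \<and> 1 \<le> b"
    using assms(1) unfolding is_partition_def by (elim conjE)
  from bspec[OF this assms(2)] show ?thesis by (simp add: split_beta)
qed

lemma is_partition_down:
  assumes "is_partition \<mu>" "(a, b) \<in> \<mu>" "1 \<le> c" "c \<le> a" "1 \<le> d" "d \<le> b"
  shows "(c, d) \<in> \<mu>"
proof -
  have "\<forall>(a, b) \<in> \<mu>. \<forall>c d. 1 \<le> c \<and> c \<le> a \<and> 1 \<le> d \<and> d \<le> b \<longrightarrow> (c, d) \<in> \<mu>"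
    using assms(1) unfolding is_partition_def by (elim conjE)
  from bspec[OF this assms(2)] show ?thesis using assms(3-6) by simp
qed

lemma initial_segment_eq_card:
  fixes S :: "nat set"
  assumes "finite S" "\<And>x. x \<in> S \<Longrightarrow> 1 \<le> x"
    and "\<And>x y. x \<in> S \<Longrightarrow> 1 \<le> y \<Longrightarrow> y \<le> x \<Longrightarrow> y \<in> S"
  shows "S = {1..card S}"
proof (cases "S = {}")
  case False
  define m where "m = Max S"
  have m: "m \<in> S" using assms(1) False by (simp add: m_def)
  have S: "S = {1..m}"
  proof (intro equalityI subsetI)
    show "x \<in> {1..m}" if "x \<in> S" for x
      using assms(1,2) that by (simp add: m_def)
    show "x \<in> S" if "x \<in> {1..m}" for x
      using assms(3)[OF m, of x] that by simp
  qed
  have "card S = m" unfolding S by simp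
  with S show ?thesis by (simp only:)
qed simp

lemma is_partition_iff_young_diagram:
  "is_partition \<mu> \<longleftrightarrow>
     (\<exists>xs. sorted_wrt (\<ge>) xs \<and> (\<forall>x \<in> set xs. 1 \<le> x) \<and> \<mu> = young_diagram xs)"
proof
  assume P: "is_partition \<mu>"
  from P have fin: "finite \<mu>" by (simp add: is_partition_def)
  have pos: "\<And>a b. (a, b) \<in> \<mu> \<Longrightarrow> 1 \<le> a \<and> 1 \<le> b"
    using is_partition_pos[OF P] by force
  have down: "\<And>a b c d. (a, b) \<in> \<mu> \<Longrightarrow> 1 \<le> c \<Longrightarrow> c \<le> a \<Longrightarrow> 1 \<le> d \<Longrightarrow> d \<le> b \<Longrightarrow> (c, d) \<in> \<mu>"
    using is_partition_down[OF P] .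
  define r where "r a = card {b. (a, b) \<in> \<mu>}" for a
  define n where "n = card {a. (a, 1) \<in> \<mu>}"
  have finrow: "finite {b. (a, b) \<in> \<mu>}" for a
    by (rule finite_subset[OF _ finite_imageI[OF fin, of snd]]) force
  have fincol: "finite {a. (a, 1) \<in> \<mu>}"
    by (rule finite_subset[OF _ finite_imageI[OF fin, of fst]]) force
  have row: "{b. (a, b) \<in> \<mu>} = {1..r a}" for a
    unfolding r_def
  proof (rule initial_segment_eq_card[OF finrow])
    show "1 \<le> x" if "x \<in> {b. (a, b) \<in> \<mu>}" for x using that pos by blast
    show "y \<in> {b. (a, b) \<in> \<mu>}" if "x \<in> {b. (a, b) \<in> \<mu>}" "1 \<le> y" "y \<le> x" for x y
      using that down[of a x a y] pos[of a x] by simp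
  qed
  have col: "{a. (a, 1) \<in> \<mu>} = {1..n}"
    unfolding n_def
  proof (rule initial_segment_eq_card[OF fincol])
    show "1 \<le> x" if "x \<in> {a. (a, 1) \<in> \<mu>}" for x using that pos by blast
    show "y \<in> {a. (a, 1) \<in> \<mu>}" if "x \<in> {a. (a, 1) \<in> \<mu>}" "1 \<le> y" "y \<le> x" for x y
      using that down[of x 1 y 1] by simp
  qed
  have mem: "(a, b) \<in> \<mu> \<longleftrightarrow> 1 \<le> b \<and> b \<le> r a" for a b
    using row[of a] by (auto simp: set_eq_iff)
  have mem1: "(a, 1) \<in> \<mu> \<longleftrightarrow> 1 \<le> a \<and> a \<le> n" for a
    using col by (auto simp: set_eq_iff)
  have anti: "r a' \<le> r a" if "1 \<le> a" "a \<le> a'" for a a'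
    unfolding r_def
  proof (rule card_mono[OF finrow], rule subsetI)
    fix b assume "b \<in> {b. (a', b) \<in> \<mu>}"
    then show "b \<in> {b. (a, b) \<in> \<mu>}" using that down[of a' b a b] pos[of a' b] by simp
  qed
  have rpos: "1 \<le> r a" if "1 \<le> a" "a \<le> n" for a
    using mem1[of a] mem[of a 1] that by auto
  define xs where "xs = map r [1..<Suc n]"
  have nth: "xs ! i = r (Suc i)" if "i < n" for i
    using that by (simp add: xs_def del: upt_Suc)
  have len: "length xs = n" by (simp add: xs_def)
  have "sorted_wrt (\<ge>) xs"
    unfolding sorted_wrt_iff_nth_less len
  proof (intro allI impI)
    fix i j assume "i < j" "j < n"
    then show "xs ! j \<le> xs ! i" using nth[of i] nth[of j] anti[of "Suc i" "Suc j"] by simp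
  qed
  moreover have "\<forall>x \<in> set xs. 1 \<le> x"
  proof
    fix x assume "x \<in> set xs"
    then obtain i where "i < n" "x = xs ! i" by (metis in_set_conv_nth len)
    then show "1 \<le> x" using nth[of i] rpos[of "Suc i"] by simp
  qed
  moreover have "\<mu> = young_diagram xs"
  proof (rule set_eqI, clarify)
    fix a b
    have "(a, b) \<in> \<mu> \<Longrightarrow> 1 \<le> a \<and> a \<le> n"
      using down[of a b a 1] pos[of a b] mem1[of a] by auto
    moreover have "xs ! (a - 1) = r a" if "1 \<le> a" "a \<le> n"
      using nth[of "a - 1"] that by (cases a) auto
    ultimately show "(a, b) \<in> \<mu> \<longleftrightarrow> (a, b) \<in> young_diagram xs"
      using mem[of a b] by (auto simp: young_diagram_def len)
  qed
  ultimately show "\<exists>xs. sorted_wrt (\<ge>) xs \<and> (\<forall>x \<in> set xs. 1 \<le> x) \<and> \<mu> = young_diagram xs"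
    by blast
next
  assume "\<exists>xs. sorted_wrt (\<ge>) xs \<and> (\<forall>x \<in> set xs. 1 \<le> x) \<and> \<mu> = young_diagram xs"
  then obtain xs where s: "sorted_wrt (\<ge>) xs" and mu: "\<mu> = young_diagram xs" by blast
  have anti: "xs ! (a - 1) \<le> xs ! (c - 1)" if "1 \<le> c" "c \<le> a" "a \<le> length xs" for a c
  proof (cases "c = a")
    case False
    then show ?thesis
      using that sorted_wrt_nth_less[OF s, of "c - 1" "a - 1"] by auto
  qed simp
  have "young_diagram xs \<subseteq> (\<Union>a \<in> {1..length xs}. {a} \<times> {1..xs ! (a - 1)})"
    by (auto simp: young_diagram_def)
  then have "finite (young_diagram xs)" by (rule finite_subset) auto
  moreover have "(c, d) \<in> young_diagram xs"
    if "(a, b) \<in> young_diagram xs" "1 \<le> c" "c \<le> a" "1 \<le> d" "d \<le> b" for a b c d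
    using that anti[of c a] by (auto simp: young_diagram_def)
  ultimately show "is_partition \<mu>"
    unfolding is_partition_def mu
  proof (intro conjI)
    show "\<forall>(a, b) \<in> young_diagram xs. 1 \<le> a \<and> 1 \<le> b"
      by (simp add: young_diagram_def)
  qed (simp, blast)
qed

definition hook_length :: "position set \<Rightarrow> position \<Rightarrow> nat" where
  "hook_length \<mu> = (\<lambda>(a, b). card {(c, d) \<in> \<mu>. (c = a \<and> b \<le> d) \<or> (d = b \<and> a \<le> c)})"

definition is_JM_partition :: "nat \<Rightarrow> position set \<Rightarrow> bool" where
  "is_JM_partition l \<mu> \<longleftrightarrow> is_partition \<mu> \<and>
     \<not> (\<exists>a b x y. (a, b) \<in> \<mu> \<and> (a, y) \<in> \<mu> \<and> (x, b) \<in> \<mu> \<and>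
          l dvd hook_length \<mu> (a, b) \<and>
          \<not> l dvd hook_length \<mu> (a, y) \<and>
          \<not> l dvd hook_length \<mu> (x, b))"


section \<open>The ladder crystal\<close>

definition residue :: "nat \<Rightarrow> position \<Rightarrow> int" where
  "residue l = (\<lambda>(a, b). (int b - int a) mod int l)"

definition ladder :: "nat \<Rightarrow> position \<Rightarrow> position set" where
  "ladder l = (\<lambda>(a, b). {(c, d). 1 \<le> c \<and> 1 \<le> d \<and>
     int c - int a = (int l - 1) * (int b - int d)})"

definition ladder_index :: "nat \<Rightarrow> position \<Rightarrow> int" where
  "ladder_index l = (\<lambda>(a, b). int a + (int l - 1) * (int b - 1))"

lemma ladder_iff_index:
  assumes "1 \<le> fst q" "1 \<le> snd q"
  shows "q \<in> ladder l p \<longleftrightarrow> ladder_index l q = ladder_index l p"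
  using assms by (cases p; cases q) (auto simp: ladder_def ladder_index_def algebra_simps)

definition removable :: "position set \<Rightarrow> position \<Rightarrow> bool" where
  "removable \<mu> p \<longleftrightarrow> p \<in> \<mu> \<and> is_partition (\<mu> - {p})"

definition addable :: "position set \<Rightarrow> position \<Rightarrow> bool" where
  "addable \<mu> p \<longleftrightarrow> p \<notin> \<mu> \<and> is_partition (insert p \<mu>)"

datatype sign = Plus | Minus

type_synonym signature = "(sign \<times> position) list"

definition signature_letters :: "nat \<Rightarrow> int \<Rightarrow> position set \<Rightarrow> (sign \<times> position) set" where
  "signature_letters l i \<mu> =
     {(Plus, p) | p. addable \<mu> p \<and> residue l p = i} \<union>
     {(Minus, p) | p. removable \<mu> p \<and> residue l p = i}"

text \<open>Left ladders before right ladders; on a common ladder, top to bottom.\<close>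

definition read_before :: "nat \<Rightarrow> position \<Rightarrow> position \<Rightarrow> bool" where
  "read_before l p q \<longleftrightarrow>
     (if q \<in> ladder l p then fst p < fst q else ladder_index l p < ladder_index l q)"

definition ladder_signature :: "nat \<Rightarrow> int \<Rightarrow> position set \<Rightarrow> signature" where
  "ladder_signature l i \<mu> =
     (THE w. set w = signature_letters l i \<mu> \<and>
             sorted_wrt (\<lambda>x y. read_before l (snd x) (snd y)) w)"

inductive cancel :: "signature \<Rightarrow> signature \<Rightarrow> bool" where
  "cancel (u @ (Minus, p) # (Plus, q) # v) (u @ v)"

definition reduced_signature :: "signature \<Rightarrow> signature" where
  "reduced_signature w = (THE w'. cancel\<^sup>*\<^sup>* w w' \<and> \<not> (\<exists>w''. cancel w' w''))"

text \<open>\<open>None\<close> plays the role of \<open>0\<close>.\<close>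

definition f_hat :: "nat \<Rightarrow> int \<Rightarrow> position set \<Rightarrow> position set option" where
  "f_hat l i \<mu> =
     (let ps = filter (\<lambda>x. fst x = Plus) (reduced_signature (ladder_signature l i \<mu>))
      in if ps = [] then None else Some (insert (snd (last ps)) \<mu>))"

inductive_set ladder_crystal :: "nat \<Rightarrow> position set set" for l :: nat where
  empty: "{} \<in> ladder_crystal l"
| step: "\<mu> \<in> ladder_crystal l \<Longrightarrow> 0 \<le> i \<Longrightarrow> i < int l \<Longrightarrow> f_hat l i \<mu> = Some \<nu> \<Longrightarrow>
           \<nu> \<in> ladder_crystal l"


section \<open>The two definite descriptions are well defined\<close>

lemma read_before_iff:
  assumes "1 \<le> fst q" "1 \<le> snd q"
  shows "read_before l p q \<longleftrightarrow>
     ladder_index l p < ladder_index l q \<or>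
     ladder_index l p = ladder_index l q \<and> fst p < fst q"
  using ladder_iff_index[OF assms, of l p] by (auto simp: read_before_def)

lemma sorted_wrt_ex1:
  assumes "finite S"
    and irr: "\<And>x. x \<in> S \<Longrightarrow> \<not> R x x"
    and trans: "\<And>x y z. x \<in> S \<Longrightarrow> y \<in> S \<Longrightarrow> z \<in> S \<Longrightarrow> R x y \<Longrightarrow> R y z \<Longrightarrow> R x z"
    and total: "\<And>x y. x \<in> S \<Longrightarrow> y \<in> S \<Longrightarrow> x \<noteq> y \<Longrightarrow> R x y \<or> R y x"
  shows "\<exists>!w. set w = S \<and> sorted_wrt R w"
  using assms
proof (induction "card S" arbitrary: S)
  case 0
  have S: "S = {}" using 0(1,2) by simp
  show ?case unfolding S by (rule ex1I[of _ "[]"]) simp_all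
next
  case (Suc n)
  have "\<exists>m \<in> S. \<forall>y \<in> S. y \<noteq> m \<longrightarrow> R m y"
  proof -
    have "\<exists>m \<in> T. \<forall>y \<in> T. y \<noteq> m \<longrightarrow> R m y" if "finite T" "T \<noteq> {}" "T \<subseteq> S" for T
      using that
    proof (induction rule: finite_ne_induct)
      case (insert x F)
      then obtain m where m: "m \<in> F" "\<forall>y \<in> F. y \<noteq> m \<longrightarrow> R m y" by auto
      have mx: "m \<noteq> x" "m \<in> S" "x \<in> S" using m insert by auto
      show ?case
      proof (cases "R m x")
        case True
        then show ?thesis using m by auto
      next
        case False
        then have "R x m" using Suc.prems(4) mx by blast
        then have "R x y" if "y \<in> F" for y
          using m mx that Suc.prems(3)[of x m y] insert.prems by (cases "y = m") auto
        then show ?thesis by auto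
      qed
    qed simp
    moreover have "S \<noteq> {}" using Suc.hyps(2) by auto
    ultimately show ?thesis using Suc.prems(1) by blast
  qed
  then obtain m where m: "m \<in> S" "\<And>y. y \<in> S \<Longrightarrow> y \<noteq> m \<Longrightarrow> R m y" by blast
  have ex1: "\<exists>!w. set w = S - {m} \<and> sorted_wrt R w"
  proof (rule Suc.hyps(1))
    show "n = card (S - {m})" using Suc.hyps(2) Suc.prems(1) m(1) by simp
    show "finite (S - {m})" using Suc.prems(1) by simp
    show "\<not> R x x" if "x \<in> S - {m}" for x
      using that Suc.prems(2) by blast
    show "R x z" if "x \<in> S - {m}" "y \<in> S - {m}" "z \<in> S - {m}" "R x y" "R y z" for x y z
      using that Suc.prems(3)[of x y z] by simp
    show "R x y \<or> R y x" if "x \<in> S - {m}" "y \<in> S - {m}" "x \<noteq> y" for x y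
      using that Suc.prems(4)[of x y] by simp
  qed
  from ex1_implies_ex[OF ex1] obtain w where w: "set w = S - {m} \<and> sorted_wrt R w" ..
  show ?case
  proof (rule ex1I[of _ "m # w"])
    show "set (m # w) = S \<and> sorted_wrt R (m # w)"
      using w m by auto
  next
    fix v assume v: "set v = S \<and> sorted_wrt R v"
    have "v \<noteq> []" using v m(1) by auto
    then obtain x v' where vx: "v = x # v'" by (cases v) simp_all
    have xS: "x \<in> S" and v'S: "set v' \<subseteq> S" using v vx by auto
    have xv: "\<forall>y \<in> set v'. R x y" using v vx by auto
    have "x = m"
    proof (rule ccontr)
      assume "x \<noteq> m"
      then have "R x m" "R m x" using v vx xv m xS by auto
      then show False using Suc.prems(2)[OF xS] Suc.prems(3)[OF xS m(1) xS] by blast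
    qed
    moreover have "x \<notin> set v'" using xv Suc.prems(2)[OF xS] by blast
    ultimately have "set v' = S - {m} \<and> sorted_wrt R v'" using v vx by auto
    then have "v' = w" using the1_equality[OF ex1, of v'] the1_equality[OF ex1 w] by simp
    then show "v = m # w" using vx \<open>x = m\<close> by simp
  qed
qed

lemma finite_addable:
  assumes P: "is_partition \<mu>"
  shows "finite {p. addable \<mu> p}"
proof -
  have fin: "finite \<mu>" using P by (simp add: is_partition_def)
  have "p \<in> insert 1 (Suc ` fst ` \<mu>) \<times> insert 1 (Suc ` snd ` \<mu>)" if "addable \<mu> p" for p
  proof -
    obtain a b where p: "p = (a, b)" by (cases p)
    have Q: "is_partition (insert (a, b) \<mu>)" using that p by (simp add: addable_def)
    then have ab: "1 \<le> a" "1 \<le> b" using is_partition_pos[of _ "(a, b)"] by auto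
    have down: "(c, d) \<in> insert (a, b) \<mu>" if "1 \<le> c" "c \<le> a" "1 \<le> d" "d \<le> b" for c d
      using is_partition_down[OF Q insertI1] that .
    have "a = 1 \<or> a \<in> Suc ` fst ` \<mu>"
    proof (cases "a = 1")
      case False
      with ab obtain a' where a': "a = Suc a'" "1 \<le> a'" by (cases a) auto
      then have "(a', b) \<in> \<mu>" using down[of a' b] ab by auto
      then have "a' \<in> fst ` \<mu>" by force
      then show ?thesis using a' by blast
    qed simp
    moreover have "b = 1 \<or> b \<in> Suc ` snd ` \<mu>"
    proof (cases "b = 1")
      case False
      with ab obtain b' where b': "b = Suc b'" "1 \<le> b'" by (cases b) auto
      then have "(a, b') \<in> \<mu>" using down[of a b'] ab by auto
      then have "b' \<in> snd ` \<mu>" by force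
      then show ?thesis using b' by blast
    qed simp
    ultimately show ?thesis unfolding p mem_Sigma_iff insert_iff by (rule conjI)
  qed
  then have "{p. addable \<mu> p} \<subseteq> insert 1 (Suc ` fst ` \<mu>) \<times> insert 1 (Suc ` snd ` \<mu>)"
    by (intro subsetI) (simp only: mem_Collect_eq)
  then show ?thesis
    by (rule finite_subset) (intro finite_cartesian_product finite.insertI finite_imageI fin)
qed

lemma signature_letters_sign:
  assumes "x \<in> signature_letters l i \<mu>"
  shows "fst x = (if snd x \<in> \<mu> then Minus else Plus)"
  using assms unfolding signature_letters_def addable_def removable_def
  by (elim UnE CollectE exE conjE) simp_all

lemma ladder_signature_ex1:
  assumes P: "is_partition \<mu>" and l: "2 \<le> l"
  shows "\<exists>!w. set w = signature_letters l i \<mu> \<and>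
              sorted_wrt (\<lambda>x y. read_before l (snd x) (snd y)) w"
proof (rule sorted_wrt_ex1)
  let ?S = "signature_letters l i \<mu>"
  have "finite \<mu>" using P by (simp add: is_partition_def)
  moreover have "?S \<subseteq> Pair Plus ` {p. addable \<mu> p} \<union> Pair Minus ` \<mu>"
    by (auto simp: signature_letters_def removable_def)
  ultimately show "finite ?S"
    using finite_addable[OF P] by (meson finite_UnI finite_imageI finite_subset)
  have pos: "1 \<le> fst (snd x) \<and> 1 \<le> snd (snd x)" if "x \<in> ?S" for x
    using that P is_partition_pos[of \<mu>] is_partition_pos[of "insert (snd x) \<mu>" "snd x"]
    by (auto simp: signature_letters_def removable_def addable_def)
  have rb: "read_before l (snd x) (snd y) \<longleftrightarrow>
      ladder_index l (snd x) < ladder_index l (snd y) \<or>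
      ladder_index l (snd x) = ladder_index l (snd y) \<and> fst (snd x) < fst (snd y)"
    if "y \<in> ?S" for x y
    using pos[OF that] by (intro read_before_iff) simp_all
  show "\<not> read_before l (snd x) (snd x)" if "x \<in> ?S" for x
    using that by (simp add: rb)
  show "read_before l (snd x) (snd z)" if "x \<in> ?S" "y \<in> ?S" "z \<in> ?S"
    "read_before l (snd x) (snd y)" "read_before l (snd y) (snd z)" for x y z
    using that by (auto simp: rb)
  show "read_before l (snd x) (snd y) \<or> read_before l (snd y) (snd x)"
    if "x \<in> ?S" "y \<in> ?S" "x \<noteq> y" for x y
  proof (rule ccontr)
    assume "\<not> ?thesis"
    then have "ladder_index l (snd x) = ladder_index l (snd y)" "fst (snd x) = fst (snd y)"
      using that by (auto simp: rb)
    then have "snd x = snd y"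
      using l by (cases "snd x"; cases "snd y") (auto simp: ladder_index_def)
    moreover have "fst x = fst y"
      using signature_letters_sign[OF that(1)] signature_letters_sign[OF that(2)] \<open>snd x = snd y\<close>
      by (simp only:)
    ultimately have "x = y" by (rule prod_eqI[rotated])
    then show False using that(3) by contradiction
  qed
qed

text \<open>The reduced word can be computed by a stack, scanning the word from right to left.\<close>

definition push :: "sign \<times> position \<Rightarrow> signature \<Rightarrow> signature" where
  "push x w = (if fst x = Minus \<and> w \<noteq> [] \<and> fst (hd w) = Plus then tl w else x # w)"

lemma foldr_push_cancel: "cancel w w' \<Longrightarrow> foldr push w [] = foldr push w' []"
  by (induction rule: cancel.induct) (simp add: push_def)

lemma cancel_Cons: "cancel w w' \<Longrightarrow> cancel (x # w) (x # w')"
  by (induction rule: cancel.induct) (metis append_Cons cancel.intros)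

lemma cancel_rtranclp_Cons: "cancel\<^sup>*\<^sup>* w w' \<Longrightarrow> cancel\<^sup>*\<^sup>* (x # w) (x # w')"
  by (induction rule: rtranclp_induct) (auto intro: rtranclp.rtrancl_into_rtrancl cancel_Cons)

lemma cancel_foldr_push: "cancel\<^sup>*\<^sup>* w (foldr push w [])"
proof (induction w)
  case (Cons x w)
  let ?v = "foldr push w []"
  have "cancel\<^sup>*\<^sup>* (x # w) (x # ?v)" using Cons by (rule cancel_rtranclp_Cons)
  moreover have "cancel\<^sup>*\<^sup>* (x # ?v) (push x ?v)"
  proof (cases "fst x = Minus \<and> ?v \<noteq> [] \<and> fst (hd ?v) = Plus")
    case True
    then have "x # ?v = [] @ (Minus, snd x) # (Plus, snd (hd ?v)) # tl ?v"
      by (metis append_Nil list.collapse prod.collapse)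
    then have "cancel (x # ?v) ([] @ tl ?v)" by (metis cancel.intros)
    then show ?thesis using True by (simp add: push_def)
  qed (auto simp: push_def)
  ultimately show ?case by simp
qed simp

lemma foldr_push_irreducible: "\<not> (\<exists>w''. cancel w w'') \<Longrightarrow> foldr push w [] = w"
proof (induction w)
  case (Cons x w)
  then have w: "foldr push w [] = w" using cancel_Cons by blast
  have "\<not> (fst x = Minus \<and> w \<noteq> [] \<and> fst (hd w) = Plus)"
  proof
    assume "fst x = Minus \<and> w \<noteq> [] \<and> fst (hd w) = Plus"
    then have "x # w = [] @ (Minus, snd x) # (Plus, snd (hd w)) # tl w"
      by (metis append_Nil list.collapse prod.collapse)
    then show False using Cons.prems by (metis cancel.intros)
  qed
  then have "push x w = x # w" by (auto simp: push_def)
  then show ?case using w by simp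
qed simp

lemma cancel_length: "cancel w w' \<Longrightarrow> length w' < length w"
  by (induction rule: cancel.induct) simp

lemma cancel_normal_form_ex: "\<exists>w'. cancel\<^sup>*\<^sup>* w w' \<and> \<not> (\<exists>w''. cancel w' w'')"
proof (induction w rule: length_induct)
  case (1 w)
  show ?case
  proof (cases "\<exists>v. cancel w v")
    case True
    then obtain v where "cancel w v" by blast
    then show ?thesis using 1 cancel_length converse_rtranclp_into_rtranclp[of cancel] by meson
  qed auto
qed

lemma cancel_normal_form_eq:
  assumes "cancel\<^sup>*\<^sup>* w w'" "\<not> (\<exists>w''. cancel w' w'')"
  shows "w' = foldr push w []"
proof -
  have "foldr push w [] = foldr push w' []"
    using assms(1) by (induction rule: rtranclp_induct) (auto dest: foldr_push_cancel)
  then show ?thesis using foldr_push_irreducible[OF assms(2)] by simp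
qed

lemma reduced_signature_ex1: "\<exists>!w'. cancel\<^sup>*\<^sup>* w w' \<and> \<not> (\<exists>w''. cancel w' w'')"
  using cancel_normal_form_ex cancel_normal_form_eq by metis

lemma reduced_signature_eq_foldr: "reduced_signature w = foldr push w []"
  using theI'[OF reduced_signature_ex1[of w]] cancel_normal_form_eq
  unfolding reduced_signature_def by blast

end

theory Submission
  imports Defs
begin

text \<open>Induction on the number of boxes.  If a JM partition has an addable \<open>i\<close>-box and a removable
  \<open>i\<close>-box, then the box where the row of one meets the column of the other has hook length divisible
  by \<open>l\<close>.  The removable box has hook length \<open>1\<close>, so all hook lengths in the other line through that
  corner are divisible by \<open>l\<close>; they decrease by at least \<open>l\<close> from box to box, which pushes the
  removable box to a later ladder (or further down on the same one).  Hence every ladder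
  \<open>i\<close>-signature is \<open>+\<cdots>+-\<cdots>-\<close> without any cancellation.  Remove all removable \<open>i\<close>-boxes: on the
  abacus, every bead on runner \<open>i\<close> whose left neighbour is a gap moves there, and the JM condition
  survives.  The operator \<open>f_hat l i\<close> then adds the removed boxes back, last one first.\<close>

section \<open>Row and column lengths\<close>

text \<open>As a cardinality, unlike a maximum, this gives empty rows length 0.\<close>

definition row_length :: "position set \<Rightarrow> nat \<Rightarrow> nat" where
  "row_length \<mu> a = card {b. (a, b) \<in> \<mu>}"

definition col_length :: "position set \<Rightarrow> nat \<Rightarrow> nat" where
  "col_length \<mu> b = card {a. (a, b) \<in> \<mu>}"

lemma is_partitionI:
  assumes "finite \<mu>" "\<And>a b. (a, b) \<in> \<mu> \<Longrightarrow> 1 \<le> a \<and> 1 \<le> b"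
    and "\<And>a b c d. (a, b) \<in> \<mu> \<Longrightarrow> 1 \<le> c \<Longrightarrow> c \<le> a \<Longrightarrow> 1 \<le> d \<Longrightarrow> d \<le> b \<Longrightarrow> (c, d) \<in> \<mu>"
  shows "is_partition \<mu>"
  unfolding is_partition_def using assms by blast

lemma is_partition_pos':
  assumes "is_partition \<mu>" "(a, b) \<in> \<mu>"
  shows "1 \<le> a" "1 \<le> b"
  using is_partition_pos[OF assms] by auto

lemma is_partition_finite: "is_partition \<mu> \<Longrightarrow> finite \<mu>"
  by (simp add: is_partition_def)

lemma row_eq:
  assumes P: "is_partition \<mu>"
  shows "{b. (a, b) \<in> \<mu>} = {1..row_length \<mu> a}"
  unfolding row_length_def
proof (rule initial_segment_eq_card)
  show "finite {b. (a, b) \<in> \<mu>}"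
    by (rule finite_subset[OF _ finite_imageI[OF is_partition_finite[OF P], of snd]]) force
  show "1 \<le> x" if "x \<in> {b. (a, b) \<in> \<mu>}" for x
    using that is_partition_pos'[OF P] by blast
  show "y \<in> {b. (a, b) \<in> \<mu>}" if "x \<in> {b. (a, b) \<in> \<mu>}" "1 \<le> y" "y \<le> x" for x y
    using that is_partition_down[OF P, of a x a y] is_partition_pos'[OF P] by blast
qed

lemma col_eq:
  assumes P: "is_partition \<mu>"
  shows "{a. (a, b) \<in> \<mu>} = {1..col_length \<mu> b}"
  unfolding col_length_def
proof (rule initial_segment_eq_card)
  show "finite {a. (a, b) \<in> \<mu>}"
    by (rule finite_subset[OF _ finite_imageI[OF is_partition_finite[OF P], of fst]]) force
  show "1 \<le> x" if "x \<in> {a. (a, b) \<in> \<mu>}" for x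
    using that is_partition_pos'[OF P] by blast
  show "y \<in> {a. (a, b) \<in> \<mu>}" if "x \<in> {a. (a, b) \<in> \<mu>}" "1 \<le> y" "y \<le> x" for x y
    using that is_partition_down[OF P, of x b y b] is_partition_pos'[OF P] by blast
qed

lemma mem_iff_row_length:
  assumes "is_partition \<mu>"
  shows "(a, b) \<in> \<mu> \<longleftrightarrow> 1 \<le> b \<and> b \<le> row_length \<mu> a"
  using row_eq[OF assms, of a] by (auto simp: set_eq_iff)

lemma mem_iff_col_length:
  assumes "is_partition \<mu>"
  shows "(a, b) \<in> \<mu> \<longleftrightarrow> 1 \<le> a \<and> a \<le> col_length \<mu> b"
  using col_eq[OF assms, of b] by (auto simp: set_eq_iff)

lemma row_length_antimono:
  assumes "is_partition \<mu>" "1 \<le> a" "a \<le> a'"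
  shows "row_length \<mu> a' \<le> row_length \<mu> a"
proof (cases "row_length \<mu> a' = 0")
  case False
  then have "(a', row_length \<mu> a') \<in> \<mu>" using mem_iff_row_length[OF assms(1)] by simp
  then have "(a, row_length \<mu> a') \<in> \<mu>"
    using is_partition_down[OF assms(1)] assms(2,3) False by simp
  then show ?thesis using mem_iff_row_length[OF assms(1)] by simp
qed simp

lemma col_length_antimono:
  assumes "is_partition \<mu>" "1 \<le> b" "b \<le> b'"
  shows "col_length \<mu> b' \<le> col_length \<mu> b"
proof (cases "col_length \<mu> b' = 0")
  case False
  then have "(col_length \<mu> b', b') \<in> \<mu>" using mem_iff_col_length[OF assms(1)] by simp
  then have "(col_length \<mu> b', b) \<in> \<mu>"
    using is_partition_down[OF assms(1)] assms(2,3) False by simp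
  then show ?thesis using mem_iff_col_length[OF assms(1)] by simp
qed simp

section \<open>Removable and addable boxes in terms of their neighbours\<close>

lemma removable_iff:
  assumes P: "is_partition \<mu>"
  shows "removable \<mu> (a, b) \<longleftrightarrow> (a, b) \<in> \<mu> \<and> (Suc a, b) \<notin> \<mu> \<and> (a, Suc b) \<notin> \<mu>"
proof
  assume R: "removable \<mu> (a, b)"
  then have Q: "is_partition (\<mu> - {(a, b)})" and ab: "(a, b) \<in> \<mu>"
    by (simp_all add: removable_def)
  have "1 \<le> a" "1 \<le> b" using is_partition_pos'[OF P ab] .
  then show "(a, b) \<in> \<mu> \<and> (Suc a, b) \<notin> \<mu> \<and> (a, Suc b) \<notin> \<mu>"
    using ab is_partition_down[OF Q, of "Suc a" b a b] is_partition_down[OF Q, of a "Suc b" a b]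
    by auto
next
  assume A: "(a, b) \<in> \<mu> \<and> (Suc a, b) \<notin> \<mu> \<and> (a, Suc b) \<notin> \<mu>"
  then have ab: "1 \<le> a" "1 \<le> b" using is_partition_pos'[OF P] by blast+
  have "is_partition (\<mu> - {(a, b)})"
  proof (rule is_partitionI)
    show "finite (\<mu> - {(a, b)})" using is_partition_finite[OF P] by simp
    show "1 \<le> c \<and> 1 \<le> d" if "(c, d) \<in> \<mu> - {(a, b)}" for c d
      using that is_partition_pos'[OF P] by blast
    fix x y c d
    assume xy: "(x, y) \<in> \<mu> - {(a, b)}" "1 \<le> c" "c \<le> x" "1 \<le> d" "d \<le> y"
    have "(c, d) \<in> \<mu>" using xy is_partition_down[OF P] by blast
    moreover have "(c, d) \<noteq> (a, b)"
    proof
      assume "(c, d) = (a, b)"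
      \<comment> \<open>A surviving box that needs \<open>(a, b)\<close> lies strictly further down
        or right, which would put one of the two excluded neighbours into
        \<open>\<mu>\<close>.\<close>
      then have "Suc a \<le> x \<or> Suc b \<le> y" "a \<le> x" "b \<le> y" using xy by auto
      then show False
        using A ab xy(1) is_partition_down[OF P, of x y "Suc a" b]
          is_partition_down[OF P, of x y a "Suc b"] by auto
    qed
    ultimately show "(c, d) \<in> \<mu> - {(a, b)}" by simp
  qed
  then show "removable \<mu> (a, b)" using A by (simp add: removable_def)
qed

lemma addable_iff:
  assumes P: "is_partition \<mu>"
  shows "addable \<mu> (a, b) \<longleftrightarrow> (a, b) \<notin> \<mu> \<and> 1 \<le> a \<and> 1 \<le> b \<and>
    (a = 1 \<or> (a - 1, b) \<in> \<mu>) \<and> (b = 1 \<or> (a, b - 1) \<in> \<mu>)"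
proof
  assume "addable \<mu> (a, b)"
  then have Q: "is_partition (insert (a, b) \<mu>)" and n: "(a, b) \<notin> \<mu>"
    by (simp_all add: addable_def)
  have ab: "1 \<le> a" "1 \<le> b" using is_partition_pos'[OF Q, of a b] by simp_all
  show "(a, b) \<notin> \<mu> \<and> 1 \<le> a \<and> 1 \<le> b \<and>
    (a = 1 \<or> (a - 1, b) \<in> \<mu>) \<and> (b = 1 \<or> (a, b - 1) \<in> \<mu>)"
    using n ab is_partition_down[OF Q, of a b "a - 1" b] is_partition_down[OF Q, of a b a "b - 1"]
    by fastforce
next
  assume A: "(a, b) \<notin> \<mu> \<and> 1 \<le> a \<and> 1 \<le> b \<and>
    (a = 1 \<or> (a - 1, b) \<in> \<mu>) \<and> (b = 1 \<or> (a, b - 1) \<in> \<mu>)"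
  have "is_partition (insert (a, b) \<mu>)"
  proof (rule is_partitionI)
    show "finite (insert (a, b) \<mu>)" using is_partition_finite[OF P] by simp
    show "1 \<le> c \<and> 1 \<le> d" if "(c, d) \<in> insert (a, b) \<mu>" for c d
      using that A is_partition_pos'[OF P] by blast
    fix x y c d
    assume xy: "(x, y) \<in> insert (a, b) \<mu>" "1 \<le> c" "c \<le> x" "1 \<le> d" "d \<le> y"
    show "(c, d) \<in> insert (a, b) \<mu>"
    proof (cases "(x, y) = (a, b) \<and> (c, d) \<noteq> (a, b)")
      case True
      \<comment> \<open>Only boxes required by the new box are in question: each lies weakly above
        and left of its upper or its left neighbour.\<close>
      then have "c \<le> a - 1 \<and> a \<noteq> 1 \<or> d \<le> b - 1 \<and> b \<noteq> 1" "c \<le> a" "d \<le> b" using xy by auto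
      then show ?thesis
        using A xy is_partition_down[OF P, of "a - 1" b c d]
          is_partition_down[OF P, of a "b - 1" c d] by auto
    next
      case False
      then show ?thesis using xy is_partition_down[OF P, of x y c d] by auto
    qed
  qed
  then show "addable \<mu> (a, b)" using A by (simp add: addable_def)
qed

lemma removable_lengths:
  assumes P: "is_partition \<mu>" and R: "removable \<mu> (a, b)"
  shows "1 \<le> a" "1 \<le> b" "row_length \<mu> a = b" "col_length \<mu> b = a"
proof -
  from R removable_iff[OF P]
  have *: "(a, b) \<in> \<mu>" "(Suc a, b) \<notin> \<mu>" "(a, Suc b) \<notin> \<mu>" by blast+
  show "1 \<le> a" "1 \<le> b" using is_partition_pos'[OF P *(1)] .
  show "row_length \<mu> a = b" using * mem_iff_row_length[OF P, of a] by force
  show "col_length \<mu> b = a" using * mem_iff_col_length[OF P, of _ b] by force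
qed

lemma addable_lengths:
  assumes P: "is_partition \<mu>" and A: "addable \<mu> (a, b)"
  shows "1 \<le> a" "1 \<le> b" "Suc (row_length \<mu> a) = b" "Suc (col_length \<mu> b) = a"
proof -
  from A addable_iff[OF P, of a b]
  have *: "(a, b) \<notin> \<mu>" "1 \<le> a" "1 \<le> b" "a = 1 \<or> (a - 1, b) \<in> \<mu>" "b = 1 \<or> (a, b - 1) \<in> \<mu>"
    by blast+
  show "1 \<le> a" "1 \<le> b" using * by blast+
  show "Suc (row_length \<mu> a) = b" using * mem_iff_row_length[OF P, of a] by force
  show "Suc (col_length \<mu> b) = a" using * mem_iff_col_length[OF P, of _ b] by force
qed

lemma ex_removable:
  assumes P: "is_partition \<mu>" and "\<mu> \<noteq> {}"
  shows "\<exists>r. removable \<mu> r"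
proof -
  obtain c d where cd: "(c, d) \<in> \<mu>" using assms(2) by auto
  \<comment> \<open>\<open>a\<close> is the last nonempty row; its last box has nothing below it or
    to its right.\<close>
  define a where "a = col_length \<mu> 1"
  define b where "b = row_length \<mu> a"
  have "(c, 1) \<in> \<mu>" using is_partition_down[OF P cd] is_partition_pos'[OF P cd] by simp
  then have "(a, 1) \<in> \<mu>" and n: "(Suc a, 1) \<notin> \<mu>"
    using mem_iff_col_length[OF P, of _ 1] by (auto simp: a_def)
  then have b: "(a, b) \<in> \<mu>" "(a, Suc b) \<notin> \<mu>" "1 \<le> b"
    using mem_iff_row_length[OF P, of a] by (auto simp: b_def)
  then have "(Suc a, b) \<notin> \<mu>" using n is_partition_down[OF P, of "Suc a" b "Suc a" 1] by auto
  then show ?thesis using b removable_iff[OF P] by blast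
qed

section \<open>Beads and gaps\<close>

text \<open>The beta-numbers of the infinite abacus (Maya diagram). Empty rows contribute beads too,
  so all sufficiently small integers are occupied.\<close>

definition row_bead :: "position set \<Rightarrow> nat \<Rightarrow> int" where
  "row_bead \<mu> a = int (row_length \<mu> a) - int a"

text \<open>The offset \<open>- 1\<close> accounts for the corner box of a hook: bead minus gap is
  then the hook length itself, and the gaps are exactly the unoccupied positions.\<close>

definition col_gap :: "position set \<Rightarrow> nat \<Rightarrow> int" where
  "col_gap \<mu> b = int b - int (col_length \<mu> b) - 1"

definition beads :: "position set \<Rightarrow> int set" where
  "beads \<mu> = row_bead \<mu> ` {1..}"

text \<open>The hook splits into the boxes of row \<open>a\<close> from column \<open>b\<close> on
  and the boxes of column \<open>b\<close> strictly below row \<open>a\<close>; the two counts add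
  up to the difference.\<close>

lemma hook_length_eq:
  assumes P: "is_partition \<mu>" and ab: "(a, b) \<in> \<mu>"
  shows "int (hook_length \<mu> (a, b)) = row_bead \<mu> a - col_gap \<mu> b"
proof -
  have r: "1 \<le> b" "b \<le> row_length \<mu> a" and c: "1 \<le> a" "a \<le> col_length \<mu> b"
    using ab mem_iff_row_length[OF P] mem_iff_col_length[OF P] by blast+
  have "{(c, d) \<in> \<mu>. (c = a \<and> b \<le> d) \<or> (d = b \<and> a \<le> c)} =
      {a} \<times> {b..row_length \<mu> a} \<union> {Suc a..col_length \<mu> b} \<times> {b}" (is "?H = ?R \<union> ?C")
  proof (rule set_eqI, clarify)
    fix c d
    show "(c, d) \<in> ?H \<longleftrightarrow> (c, d) \<in> ?R \<union> ?C"
    proof (cases "c = a")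
      case True
      then show ?thesis using r(1) mem_iff_row_length[OF P, of a d] by auto
    next
      case False
      then show ?thesis using c(1) mem_iff_col_length[OF P, of c b] by auto
    qed
  qed
  moreover have "card (?R \<union> ?C) = card ?R + card ?C"
    by (rule card_Un_disjoint) auto
  ultimately have "hook_length \<mu> (a, b) = card ?R + card ?C"
    by (simp add: hook_length_def)
  then show ?thesis using r c by (simp add: card_cartesian_product row_bead_def col_gap_def)
qed

text \<open>The difference is arm plus leg plus 1. Inside the diagram arm and leg are nonnegative;
  outside both are at most -1. So the difference never vanishes, which makes beads and gaps
  disjoint.\<close>

lemma mem_iff_col_gap_less:
  assumes P: "is_partition \<mu>" and "1 \<le> a" "1 \<le> b"
  shows "(a, b) \<in> \<mu> \<longleftrightarrow> col_gap \<mu> b < row_bead \<mu> a"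
    and "(a, b) \<notin> \<mu> \<longleftrightarrow> row_bead \<mu> a < col_gap \<mu> b"
  using assms(2,3) mem_iff_row_length[OF P, of a b] mem_iff_col_length[OF P, of a b]
  by (auto simp: row_bead_def col_gap_def)

lemma row_bead_strict_antimono:
  assumes "is_partition \<mu>" "1 \<le> a" "a < a'"
  shows "row_bead \<mu> a' < row_bead \<mu> a"
  using row_length_antimono[OF assms(1,2), of a'] assms(3) by (simp add: row_bead_def)

lemma col_gap_strict_mono:
  assumes "is_partition \<mu>" "1 \<le> b" "b < b'"
  shows "col_gap \<mu> b < col_gap \<mu> b'"
  using col_length_antimono[OF assms(1,2), of b'] assms(3) by (simp add: col_gap_def)

text \<open>Disjointness is \<open>mem_iff_col_gap_less\<close>. Conversely, the first row whose
  bead lies below \<open>p\<close> determines a column that ends just above that row, and its gap is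
  \<open>p\<close>.\<close>

lemma not_bead_iff:
  assumes P: "is_partition \<mu>"
  shows "p \<notin> beads \<mu> \<longleftrightarrow> (\<exists>b\<ge>1. p = col_gap \<mu> b)"
proof
  assume "\<exists>b\<ge>1. p = col_gap \<mu> b"
  then show "p \<notin> beads \<mu>"
    using mem_iff_col_gap_less[OF P] by (fastforce simp: beads_def)
next
  assume p: "p \<notin> beads \<mu>"
  have "\<exists>a. 1 \<le> a \<and> row_bead \<mu> a \<le> p"
  proof (intro exI conjI)
    \<comment> \<open>So far down that even a row as long as the first one has its bead at or below
      \<open>p\<close>.\<close>
    let ?a = "Suc (row_length \<mu> 1 + nat \<bar>p\<bar>)"
    show "1 \<le> ?a" by simp
    show "row_bead \<mu> ?a \<le> p"
      using row_length_antimono[OF P, of 1 ?a] by (simp add: row_bead_def)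
  qed
  define a where "a = (LEAST a. 1 \<le> a \<and> row_bead \<mu> a \<le> p)"
  have a: "1 \<le> a" "row_bead \<mu> a \<le> p"
    using LeastI_ex[OF \<open>\<exists>a. 1 \<le> a \<and> row_bead \<mu> a \<le> p\<close>] by (simp_all add: a_def)
  have less: "row_bead \<mu> a < p" using a p by (auto simp: beads_def order.order_iff_strict)
  \<comment> \<open>The column in which row \<open>a\<close> meets the diagonal of content
    \<open>p\<close>.\<close>
  define b where "b = nat (p + int a)"
  have b: "int b = p + int a" "row_length \<mu> a < b"
    using less by (simp_all add: b_def row_bead_def)
  have "(a, b) \<notin> \<mu>" using b mem_iff_row_length[OF P] by simp
  moreover have "(a - 1, b) \<in> \<mu>" if "a \<noteq> 1"
  proof -
    \<comment> \<open>Minimality of \<open>a\<close>: the bead of the row above is greater than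
      \<open>p\<close>, so that row reaches column \<open>b\<close>.\<close>
    have "\<not> (1 \<le> a - 1 \<and> row_bead \<mu> (a - 1) \<le> p)"
      using not_less_Least[of "a - 1" "\<lambda>a. 1 \<le> a \<and> row_bead \<mu> a \<le> p"] a(1)
      unfolding a_def[symmetric] by simp
    then have "b \<le> row_length \<mu> (a - 1)" using that a b by (auto simp: row_bead_def)
    then show ?thesis using b mem_iff_row_length[OF P] by simp
  qed
  ultimately have "Suc (col_length \<mu> b) = a"
    using a(1) mem_iff_col_length[OF P, of _ b] by force
  then have "p = col_gap \<mu> b" using b by (simp add: col_gap_def)
  moreover have "1 \<le> b" using b(2) by simp
  ultimately show "\<exists>b\<ge>1. p = col_gap \<mu> b" by blast
qed

text \<open>Removing the last box of a row moves its bead one step left, which requires a free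
  position. Conversely, a gap there gives a box of hook length 1, whose arm and leg are
  empty.\<close>

lemma removable_iff_not_bead:
  assumes P: "is_partition \<mu>" and a: "1 \<le> a"
  shows "removable \<mu> (a, row_length \<mu> a) \<longleftrightarrow> row_bead \<mu> a - 1 \<notin> beads \<mu>"
proof
  assume R: "removable \<mu> (a, row_length \<mu> a)"
  note len = removable_lengths[OF P R]
  then have "row_bead \<mu> a - 1 = col_gap \<mu> (row_length \<mu> a)"
    by (simp add: row_bead_def col_gap_def)
  then show "row_bead \<mu> a - 1 \<notin> beads \<mu>" using not_bead_iff[OF P] len(2) by blast
next
  assume "row_bead \<mu> a - 1 \<notin> beads \<mu>"
  then obtain b where b: "1 \<le> b" "row_bead \<mu> a - 1 = col_gap \<mu> b"
    using not_bead_iff[OF P] by blast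
  then have ab: "(a, b) \<in> \<mu>" using mem_iff_col_gap_less[OF P a] by simp
  then have "b \<le> row_length \<mu> a" "a \<le> col_length \<mu> b"
    using mem_iff_row_length[OF P] mem_iff_col_length[OF P] by blast+
  then have "row_length \<mu> a = b" "col_length \<mu> b = a"
    using b by (auto simp: row_bead_def col_gap_def)
  then show "removable \<mu> (a, row_length \<mu> a)"
    using ab removable_iff[OF P] mem_iff_row_length[OF P, of a] mem_iff_col_length[OF P, of _ b]
    by auto
qed

text \<open>A box is a bead together with a smaller gap, and its hook length is their difference; the
  alternatives say that all hook lengths of its row, respectively column, are divisible.\<close>

definition JM_abacus :: "nat \<Rightarrow> int set \<Rightarrow> bool" where
  "JM_abacus l B \<longleftrightarrow> (\<forall>x y. x \<in> B \<and> y \<notin> B \<and> y < x \<and> int l dvd x - y \<longrightarrow>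
     (\<forall>z. z \<notin> B \<and> z < x \<longrightarrow> int l dvd x - z) \<or> (\<forall>w. w \<in> B \<and> y < w \<longrightarrow> int l dvd w - y))"

lemma JM_abacusD:
  assumes "JM_abacus l B" "x \<in> B" "y \<notin> B" "y < x" "int l dvd x - y"
  shows "(\<forall>z. z \<notin> B \<and> z < x \<longrightarrow> int l dvd x - z) \<or> (\<forall>w. w \<in> B \<and> y < w \<longrightarrow> int l dvd w - y)"
  using assms unfolding JM_abacus_def by blast

text \<open>Rows are beads, columns are gaps, and hook lengths are differences. The forbidden triple
  chooses its box in the row and its box in the column independently, so its absence splits into the
  two alternatives of \<open>JM_abacus\<close>.\<close>

lemma is_JM_partition_iff_abacus:
  assumes P: "is_partition \<mu>"
  shows "is_JM_partition l \<mu> \<longleftrightarrow> JM_abacus l (beads \<mu>)"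
proof -
  have dvd: "l dvd hook_length \<mu> (a, b) \<longleftrightarrow> int l dvd row_bead \<mu> a - col_gap \<mu> b"
    if "(a, b) \<in> \<mu>" for a b
    using hook_length_eq[OF P that] int_dvd_int_iff[of l "hook_length \<mu> (a, b)"] by simp
  note mem = mem_iff_col_gap_less(1)[OF P]
  show ?thesis
  proof
    assume J: "is_JM_partition l \<mu>"
    show "JM_abacus l (beads \<mu>)"
      unfolding JM_abacus_def
    proof (intro allI impI, elim conjE)
      fix x y assume x: "x \<in> beads \<mu>" and y: "y \<notin> beads \<mu>" and less: "y < x"
        and d: "int l dvd x - y"
      obtain a where a: "1 \<le> a" "x = row_bead \<mu> a" using x by (auto simp: beads_def)
      obtain b where b: "1 \<le> b" "y = col_gap \<mu> b" using y not_bead_iff[OF P] by blast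
      have ab: "(a, b) \<in> \<mu>" using mem a b less by simp
      have "\<not> ((a, d) \<in> \<mu> \<and> (c, b) \<in> \<mu> \<and> \<not> l dvd hook_length \<mu> (a, d) \<and>
          \<not> l dvd hook_length \<mu> (c, b))" for c d
        using J ab d dvd[OF ab] a b unfolding is_JM_partition_def by blast
      then consider "\<And>d. (a, d) \<in> \<mu> \<Longrightarrow> l dvd hook_length \<mu> (a, d)"
        | "\<And>c. (c, b) \<in> \<mu> \<Longrightarrow> l dvd hook_length \<mu> (c, b)" by blast
      then show "(\<forall>z. z \<notin> beads \<mu> \<and> z < x \<longrightarrow> int l dvd x - z) \<or>
          (\<forall>w. w \<in> beads \<mu> \<and> y < w \<longrightarrow> int l dvd w - y)"
      proof cases
        case 1
        have "int l dvd x - z" if z: "z \<notin> beads \<mu>" "z < x" for z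
        proof -
          obtain d where "1 \<le> d" "z = col_gap \<mu> d" using z(1) not_bead_iff[OF P] by blast
          then show ?thesis using 1[of d] z(2) a mem[of a d] dvd[of a d] by simp
        qed
        then show ?thesis by blast
      next
        case 2
        have "int l dvd w - y" if w: "w \<in> beads \<mu>" "y < w" for w
        proof -
          obtain c where "1 \<le> c" "w = row_bead \<mu> c" using w(1) by (auto simp: beads_def)
          then show ?thesis using 2[of c] w(2) b mem[of c b] dvd[of c b] by simp
        qed
        then show ?thesis by blast
      qed
    qed
  next
    assume J: "JM_abacus l (beads \<mu>)"
    show "is_JM_partition l \<mu>"
      unfolding is_JM_partition_def
    proof (intro conjI P notI, elim exE conjE)
      fix a b x y
      assume m: "(a, b) \<in> \<mu>" "(a, y) \<in> \<mu>" "(x, b) \<in> \<mu>"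
        and d: "l dvd hook_length \<mu> (a, b)" "\<not> l dvd hook_length \<mu> (a, y)"
          "\<not> l dvd hook_length \<mu> (x, b)"
      have pos: "1 \<le> a" "1 \<le> b" "1 \<le> x" "1 \<le> y" using m is_partition_pos'[OF P] by blast+
      have "row_bead \<mu> a \<in> beads \<mu>" "row_bead \<mu> x \<in> beads \<mu>" using pos by (auto simp: beads_def)
      moreover have "col_gap \<mu> b \<notin> beads \<mu>" "col_gap \<mu> y \<notin> beads \<mu>"
        using pos not_bead_iff[OF P] by blast+
      moreover have "col_gap \<mu> b < row_bead \<mu> a" "col_gap \<mu> y < row_bead \<mu> a"
        "col_gap \<mu> b < row_bead \<mu> x"
        using m mem pos by blast+
      ultimately show False
        using d dvd[OF m(1)] dvd[OF m(2)] dvd[OF m(3)] JM_abacusD[OF J] by blast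
    qed
  qed
qed

section \<open>Removing all removable boxes of one residue\<close>

definition remove_all :: "nat \<Rightarrow> int \<Rightarrow> position set \<Rightarrow> position set" where
  "remove_all l i \<mu> = \<mu> - {p. removable \<mu> p \<and> residue l p = i}"

lemma is_partition_remove_all:
  assumes P: "is_partition \<mu>"
  shows "is_partition (remove_all l i \<mu>)"
proof (rule is_partitionI)
  show "finite (remove_all l i \<mu>)" using is_partition_finite[OF P] by (simp add: remove_all_def)
  show "1 \<le> a \<and> 1 \<le> b" if "(a, b) \<in> remove_all l i \<mu>" for a b
    using that is_partition_pos'[OF P, of a b] by (simp add: remove_all_def)
  fix a b c d
  assume ab: "(a, b) \<in> remove_all l i \<mu>" "1 \<le> c" "c \<le> a" "1 \<le> d" "d \<le> b"
  then have m: "(a, b) \<in> \<mu>" by (simp add: remove_all_def)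
  have cd: "(c, d) \<in> \<mu>" using is_partition_down[OF P m ab(2-5)] .
  \<comment> \<open>A removable box ends both its row and its column, so no other box lies weakly
    below and right of it.\<close>
  have eq: "(a, b) = (c, d)" if R: "removable \<mu> (c, d)"
  proof -
    have "(a, d) \<in> \<mu>" "(c, b) \<in> \<mu>"
      using is_partition_down[OF P m, of a d] is_partition_down[OF P m, of c b] ab by simp_all
    then have "b \<le> row_length \<mu> c" "a \<le> col_length \<mu> d"
      using mem_iff_row_length[OF P] mem_iff_col_length[OF P] by blast+
    then show ?thesis
      using removable_lengths(3,4)[OF P R] ab(3,5) by simp
  qed
  show "(c, d) \<in> remove_all l i \<mu>"
  proof (rule ccontr)
    assume n: "(c, d) \<notin> remove_all l i \<mu>"
    then have "removable \<mu> (c, d)" using cd by (simp add: remove_all_def)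
    then show False using eq n ab(1) by simp
  qed
qed

text \<open>Only the last box of a row can be removable, and its content is the bead of the row.
  Hence each bead moves by at most one.\<close>

lemma row_bead_remove_all:
  assumes P: "is_partition \<mu>" and a: "1 \<le> a"
  shows "row_bead (remove_all l i \<mu>) a =
    (if row_bead \<mu> a mod int l = i \<and> row_bead \<mu> a - 1 \<notin> beads \<mu>
     then row_bead \<mu> a - 1 else row_bead \<mu> a)"
proof -
  let ?r = "row_length \<mu> a"
  have res: "residue l (a, ?r) = row_bead \<mu> a mod int l" by (simp add: residue_def row_bead_def)
  have row: "{b. (a, b) \<in> remove_all l i \<mu>} =
      {1..?r} - {b. removable \<mu> (a, b) \<and> residue l (a, b) = i}"
    unfolding row_eq[OF P, of a, symmetric] by (auto simp: remove_all_def)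
  have *: "removable \<mu> (a, b) \<longleftrightarrow> b = ?r \<and> row_bead \<mu> a - 1 \<notin> beads \<mu>" for b
    using removable_iff_not_bead[OF P a] removable_lengths(3)[OF P, of a b] by auto
  show ?thesis
  proof (cases "row_bead \<mu> a mod int l = i \<and> row_bead \<mu> a - 1 \<notin> beads \<mu>")
    case True
    then have "removable \<mu> (a, ?r)" using * by blast
    then have r: "1 \<le> ?r" using removable_lengths(2)[OF P] by blast
    have e: "{b. removable \<mu> (a, b) \<and> residue l (a, b) = i} = {?r}"
      using * True res by auto
    have "row_length (remove_all l i \<mu>) a = ?r - 1"
      unfolding row_length_def[of "remove_all l i \<mu>"] row e using r by simp
    then show ?thesis using True r by (simp add: row_bead_def of_nat_diff)
  next
    case False
    then have e: "{b. removable \<mu> (a, b) \<and> residue l (a, b) = i} = {}"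
      using * res by auto
    have "row_length (remove_all l i \<mu>) a = ?r"
      unfolding row_length_def[of "remove_all l i \<mu>"] row e by simp
    then show ?thesis using False by (simp add: row_bead_def)
  qed
qed

section \<open>Bead moves on the abacus and the JM condition\<close>

definition shift_beads :: "nat \<Rightarrow> int \<Rightarrow> int set \<Rightarrow> int set" where
  "shift_beads l i B = {p \<in> B. \<not> (p mod int l = i \<and> p - 1 \<notin> B)} \<union>
     {p. p \<notin> B \<and> p + 1 \<in> B \<and> (p + 1) mod int l = i}"

lemma beads_remove_all:
  assumes P: "is_partition \<mu>"
  shows "beads (remove_all l i \<mu>) = shift_beads l i (beads \<mu>)"
proof (intro equalityI subsetI)
  fix p assume "p \<in> beads (remove_all l i \<mu>)"
  then obtain a where a: "1 \<le> a" "p = row_bead (remove_all l i \<mu>) a" by (auto simp: beads_def)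
  have "row_bead \<mu> a \<in> beads \<mu>" using a by (auto simp: beads_def)
  then show "p \<in> shift_beads l i (beads \<mu>)"
    using a(2) row_bead_remove_all[OF P a(1), of l i] by (auto simp: shift_beads_def)
next
  fix p assume p: "p \<in> shift_beads l i (beads \<mu>)"
  \<comment> \<open>The bead of \<open>\<mu>\<close> that ends up at \<open>p\<close>: the one at
    \<open>p\<close> if it stayed there, otherwise the one that came from the right
    neighbour.\<close>
  define q where "q = (if p \<in> beads \<mu> then p else p + 1)"
  have "q \<in> beads \<mu>" using p by (auto simp: q_def shift_beads_def)
  then obtain a where a: "1 \<le> a" "q = row_bead \<mu> a" by (auto simp: beads_def)
  have "p = row_bead (remove_all l i \<mu>) a"
  proof (cases "p \<in> beads \<mu>")
    case True
    then show ?thesis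
      using p a(2) row_bead_remove_all[OF P a(1), of l i] by (auto simp: q_def shift_beads_def)
  next
    case False
    then have "row_bead \<mu> a - 1 = p" "row_bead \<mu> a mod int l = i"
      using p a(2) by (auto simp: q_def shift_beads_def)
    then show ?thesis
      using False row_bead_remove_all[OF P a(1), of l i] by simp
  qed
  then show "p \<in> beads (remove_all l i \<mu>)" using a by (auto simp: beads_def)
qed

text \<open>Only runners \<open>i\<close> and \<open>i - 1\<close> change, so the cases follow the
  runner of \<open>x\<close>, which is also that of \<open>y\<close>. Off these two, the alternative
  valid for \<open>B\<close> carries over. On runner \<open>i - 1\<close> the column alternative
  always holds, on runner \<open>i\<close> the row alternative; these two cases mirror each
  other.\<close>

lemma JM_abacus_shift_beads:
  assumes l: "2 \<le> l" and J: "JM_abacus l B"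
  shows "JM_abacus l (shift_beads l i B)"
  unfolding JM_abacus_def
proof (intro allI impI, elim conjE)
  let ?B = "shift_beads l i B"
  define I where "I u \<longleftrightarrow> u mod int l = i" for u
  define E where "E u v \<longleftrightarrow> int l dvd u - v" for u v
  have mem: "u \<in> ?B \<longleftrightarrow> u \<in> B \<and> \<not> (I u \<and> u - 1 \<notin> B) \<or> u \<notin> B \<and> u + 1 \<in> B \<and> I (u + 1)" for u
    by (auto simp: shift_beads_def I_def)
  have E_mod: "E u v \<longleftrightarrow> u mod int l = v mod int l" for u v
    by (simp add: E_def mod_eq_dvd_iff)
  have E_sym: "E u v \<Longrightarrow> E v u" and E_trans: "E u v \<Longrightarrow> E v w \<Longrightarrow> E u w" for u v w
    by (simp_all add: E_mod)
  have E_add: "E (u + 1) (v + 1) \<longleftrightarrow> E u v" "E (u - 1) (v - 1) \<longleftrightarrow> E u v" for u v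
    by (simp_all add: E_def)
  have I_E: "I u \<Longrightarrow> I v \<longleftrightarrow> E u v" for u v by (auto simp: I_def E_mod)
  have E_Suc: "\<not> E (u + 1) u" "\<not> E u (u + 1)" "\<not> E (u - 1) u" "\<not> E u (u - 1)" for u
    using l by (auto simp: E_def zdvd_not_zless dest: zdvd_imp_le)
  have J': "(\<forall>z. z \<notin> B \<and> z < x \<longrightarrow> E x z) \<or> (\<forall>w. w \<in> B \<and> y < w \<longrightarrow> E w y)"
    if "x \<in> B" "y \<notin> B" "y < x" "E x y" for x y
    using JM_abacusD[OF J] that unfolding E_def by blast
  \<comment> \<open>Adjacent positions are never congruent because \<open>l\<close> is at least
    2.\<close>
  have gap: "u + 1 < v" if "E u v" "u < v" for u v
    using that E_Suc(2)[of u] by (cases "v = u + 1") auto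
  fix x y assume x: "x \<in> ?B" and y: "y \<notin> ?B" and less: "y < x" and "int l dvd x - y"
  then have xy: "E x y" by (simp add: E_def)
  have "(\<forall>z. z \<notin> ?B \<and> z < x \<longrightarrow> E x z) \<or> (\<forall>w. w \<in> ?B \<and> y < w \<longrightarrow> E w y)"
  proof -
    consider (other) "\<not> I x" "\<not> I (x + 1)" | (left) "I (x + 1)" | (right) "I x" by blast
    then show ?thesis
    proof cases
      case other
      then have "\<not> I y" "\<not> I (y + 1)" using xy E_add(1) I_E E_sym by metis+
      then have "x \<in> B" "y \<notin> B" using x y other mem by blast+
      from J'[OF this less xy] show ?thesis
      proof
        assume G: "\<forall>z. z \<notin> B \<and> z < x \<longrightarrow> E x z"
        have "E x z" if "z \<notin> ?B" "z < x" for z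
        proof (rule ccontr)
          assume "\<not> E x z"
          \<comment> \<open>A new gap violating the alternative must have been vacated, so its left
            neighbour was a gap already and falls under \<open>G\<close>.\<close>
          then have "I z" "z - 1 \<notin> B" using that G mem by blast+
          then have "E x (z - 1)" using G that by simp
          then have "E (x + 1) z" using E_add(1)[of x "z - 1"] by simp
          then show False using \<open>I z\<close> other(2) I_E E_sym by blast
        qed
        then show ?thesis by blast
      next
        assume G: "\<forall>w. w \<in> B \<and> y < w \<longrightarrow> E w y"
        have "E w y" if "w \<in> ?B" "y < w" for w
        proof (rule ccontr)
          assume "\<not> E w y"
          then have "I (w + 1)" "w + 1 \<in> B" using that G mem by blast+
          then have "E (w + 1) y" using G that by simp
          then show False using \<open>I (w + 1)\<close> \<open>\<not> I y\<close> I_E by blast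
        qed
        then show ?thesis by blast
      qed
    next
      case left
      have Iy: "I (y + 1)" using left xy E_add(1) I_E by blast
      then have nI: "\<not> I y" "\<not> I x" using left I_E E_Suc by blast+
      \<comment> \<open>A bead at \<open>y\<close> would have stayed, and a bead at
        \<open>y + 1\<close> would have moved into \<open>y\<close>.\<close>
      have yB: "y \<notin> B" "y + 1 \<notin> B" using y Iy nI mem[of y] by blast+
      have less': "y + 1 < x" using gap[OF E_sym[OF xy] less] .
      have "\<forall>w. w \<in> ?B \<and> y < w \<longrightarrow> E w y"
      proof (cases "x \<in> B")
        case True
        have "\<not> E x (y + 1)" using xy E_Suc(2) E_sym E_trans by blast
        \<comment> \<open>The gap \<open>y + 1\<close> refutes the row alternative for
          \<open>x\<close>, so the column one remains.\<close>
        then have G: "\<forall>w. w \<in> B \<and> y < w \<longrightarrow> E w y"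
          using J'[OF True yB(1) less xy] yB(2) less' by blast
        show ?thesis
        proof (intro allI impI, elim conjE, rule ccontr)
          fix w assume w: "w \<in> ?B" "y < w" "\<not> E w y"
          then have "I (w + 1)" "w + 1 \<in> B" using G mem by blast+
          then have "E (w + 1) y" using G w by simp
          then show False using \<open>I (w + 1)\<close> nI I_E by blast
        qed
      next
        case False
        then have x1: "x + 1 \<in> B" using x mem by blast
        have "\<not> E (x + 1) y" using xy E_Suc(2) E_sym E_trans by blast
        \<comment> \<open>The bead at \<open>x\<close> came from \<open>x + 1\<close>. For the pair
          \<open>x + 1\<close>, \<open>y + 1\<close> the gap \<open>y\<close> refutes the row
          alternative.\<close>
        then have G: "\<forall>w. w \<in> B \<and> y + 1 < w \<longrightarrow> E w (y + 1)"
          using J'[OF x1 yB(2)] E_add(1) xy yB(1) less by force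
        show ?thesis
        proof (intro allI impI, elim conjE)
          fix w assume w: "w \<in> ?B" "y < w"
          show "E w y"
          proof (cases "w \<in> B")
            case True
            then have "w \<noteq> y + 1" using yB by blast
            then have yw: "y + 1 < w" using w by simp
            then have Ew: "E w (y + 1)" using G True by blast
            then have "I w" using Iy I_E E_sym by blast
            \<comment> \<open>A bead on runner \<open>i\<close> stays only if it is blocked on its
              left; by \<open>G\<close> the blocking bead would lie on runner \<open>i\<close> as
              well, which is impossible.\<close>
            then have "w - 1 \<in> B" using w True mem by blast
            moreover have "y + 1 < w - 1" using gap[OF E_sym[OF Ew] yw] by simp
            ultimately have "E (w - 1) (y + 1)" using G by blast
            then show ?thesis using Ew E_Suc(4) E_sym E_trans by blast
          next
            case False
            then have "I (w + 1)" using w mem by blast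
            then show ?thesis using Iy I_E E_add(1) by blast
          qed
        qed
      qed
      then show ?thesis by blast
    next
      case right
      then have nI: "\<not> I (x + 1)" using I_E E_Suc by blast
      then have xB: "x \<in> B" "x - 1 \<in> B" using x right mem by blast+
      have Iy: "I y" using right xy I_E by blast
      have less': "y < x - 1" using gap[OF E_sym[OF xy] less] by simp
      have "\<forall>z. z \<notin> ?B \<and> z < x \<longrightarrow> E x z"
      proof (cases "y \<in> B")
        case False
        have "\<not> E (x - 1) y" using xy E_Suc(4) E_sym E_trans by blast
        \<comment> \<open>The bead \<open>x - 1\<close>, which blocks \<open>x\<close>, refutes the
          column alternative for \<open>y\<close>.\<close>
        then have G: "\<forall>z. z \<notin> B \<and> z < x \<longrightarrow> E x z"
          using J'[OF xB(1) False less xy] xB(2) less' by blast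
        show ?thesis using G mem I_E right by blast
      next
        case True
        then have y1: "y - 1 \<notin> B" using y mem by blast
        have "\<not> E x (y - 1)" using xy E_Suc(4) E_trans E_sym by blast
        \<comment> \<open>The position \<open>y\<close> was vacated towards \<open>y - 1\<close>.
          For the pair \<open>x - 1\<close>, \<open>y - 1\<close> the bead \<open>x\<close> refutes
          the column alternative.\<close>
        then have G: "\<forall>z. z \<notin> B \<and> z < x - 1 \<longrightarrow> E (x - 1) z"
          using J'[OF xB(2) y1] E_add(2) xy xB(1) less by force
        show ?thesis
        proof (intro allI impI, elim conjE)
          fix z assume z: "z \<notin> ?B" "z < x"
          show "E x z"
          proof (cases "z \<in> B")
            case True
            then show ?thesis using z right mem I_E by blast
          next
            case False
            then have "z \<noteq> x - 1" using xB by blast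
            then have zx: "z < x - 1" using z by simp
            then have Ez: "E (x - 1) z" using G False by blast
            then have "E x (z + 1)" using E_add(1)[of "x - 1" z] by simp
            then have "I (z + 1)" using right I_E by blast
            \<comment> \<open>Otherwise the bead at \<open>z + 1\<close> would have filled
              \<open>z\<close>. Now \<open>z\<close> and \<open>z + 1\<close> are both gaps to which
              \<open>G\<close> applies, but they are not congruent.\<close>
            then have "z + 1 \<notin> B" using z False mem by blast
            moreover have "z + 1 < x - 1" using gap[OF E_sym[OF Ez] zx] .
            ultimately have "E (x - 1) (z + 1)" using G by blast
            then show ?thesis using Ez E_Suc(2) E_sym E_trans by blast
          qed
        qed
      qed
      then show ?thesis by blast
    qed
  qed
  then show "(\<forall>z. z \<notin> ?B \<and> z < x \<longrightarrow> int l dvd x - z) \<or> (\<forall>w. w \<in> ?B \<and> y < w \<longrightarrow> int l dvd w - y)"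
    by (simp add: E_def)
qed

lemma is_JM_partition_remove_all:
  assumes "2 \<le> l" "is_JM_partition l \<mu>"
  shows "is_JM_partition l (remove_all l i \<mu>)"
proof -
  have P: "is_partition \<mu>" using assms(2) by (simp add: is_JM_partition_def)
  then have "JM_abacus l (beads (remove_all l i \<mu>))"
    using assms is_JM_partition_iff_abacus[OF P] by (simp add: beads_remove_all JM_abacus_shift_beads)
  then show ?thesis
    using is_JM_partition_iff_abacus[OF is_partition_remove_all[OF P]] by blast
qed

section \<open>The ladder signature of a JM partition\<close>

text \<open>Hook lengths strictly decrease along a row, so multiples of \<open>l\<close> drop by at
  least \<open>l\<close> per box; the last one is positive, hence at least \<open>l\<close>.\<close>

lemma hook_length_row_divisible:
  assumes P: "is_partition \<mu>"
    and dv: "\<And>d. (a, d) \<in> \<mu> \<Longrightarrow> l dvd hook_length \<mu> (a, d)"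
    and ab: "(a, b) \<in> \<mu>"
  shows "l * (Suc (row_length \<mu> a) - b) \<le> hook_length \<mu> (a, b)"
  using ab
proof (induction "row_length \<mu> a - b" arbitrary: b)
  case 0
  have "b = row_length \<mu> a" using 0 mem_iff_row_length[OF P, of a b] by simp
  moreover have "0 < hook_length \<mu> (a, b)"
    using hook_length_eq[OF P 0(2)] mem_iff_col_gap_less(1)[OF P] is_partition_pos'[OF P 0(2)] 0(2)
    by fastforce
  ultimately show ?case using dv[OF 0(2)] by (simp add: dvd_imp_le)
next
  case (Suc n)
  have b: "1 \<le> b" "Suc b \<le> row_length \<mu> a"
    using Suc mem_iff_row_length[OF P, of a b] by auto
  then have S: "(a, Suc b) \<in> \<mu>" using mem_iff_row_length[OF P] by simp
  have less: "hook_length \<mu> (a, Suc b) < hook_length \<mu> (a, b)"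
    using hook_length_eq[OF P S] hook_length_eq[OF P Suc.prems]
      col_gap_strict_mono[OF P b(1), of "Suc b"] by simp
  have "l * (Suc (row_length \<mu> a) - Suc b) \<le> hook_length \<mu> (a, Suc b)"
    using Suc.hyps(1)[OF _ S] Suc.hyps(2) by simp
  moreover have "hook_length \<mu> (a, Suc b) + l \<le> hook_length \<mu> (a, b)"
    using less dv[OF S] dv[OF Suc.prems] by (metis add.commute add_le_cancel_left dvd_diff_nat
        dvd_imp_le le_add_diff_inverse less_imp_le zero_less_diff)
  moreover have "Suc (row_length \<mu> a) - b = Suc (Suc (row_length \<mu> a) - Suc b)"
    using b by simp
  ultimately show ?case by simp
qed

text \<open>The transposed estimate, with beads decreasing down the column.\<close>

lemma hook_length_col_divisible:
  assumes P: "is_partition \<mu>"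
    and dv: "\<And>c. (c, b) \<in> \<mu> \<Longrightarrow> l dvd hook_length \<mu> (c, b)"
    and ab: "(a, b) \<in> \<mu>"
  shows "l * (Suc (col_length \<mu> b) - a) \<le> hook_length \<mu> (a, b)"
  using ab
proof (induction "col_length \<mu> b - a" arbitrary: a)
  case 0
  have "a = col_length \<mu> b" using 0 mem_iff_col_length[OF P, of a b] by simp
  moreover have "0 < hook_length \<mu> (a, b)"
    using hook_length_eq[OF P 0(2)] mem_iff_col_gap_less(1)[OF P] is_partition_pos'[OF P 0(2)] 0(2)
    by fastforce
  ultimately show ?case using dv[OF 0(2)] by (simp add: dvd_imp_le)
next
  case (Suc n)
  have a: "1 \<le> a" "Suc a \<le> col_length \<mu> b"
    using Suc mem_iff_col_length[OF P, of a b] by auto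
  then have S: "(Suc a, b) \<in> \<mu>" using mem_iff_col_length[OF P] by simp
  have less: "hook_length \<mu> (Suc a, b) < hook_length \<mu> (a, b)"
    using hook_length_eq[OF P S] hook_length_eq[OF P Suc.prems]
      row_bead_strict_antimono[OF P a(1), of "Suc a"] by simp
  have "l * (Suc (col_length \<mu> b) - Suc a) \<le> hook_length \<mu> (Suc a, b)"
    using Suc.hyps(1)[OF _ S] Suc.hyps(2) by simp
  moreover have "hook_length \<mu> (Suc a, b) + l \<le> hook_length \<mu> (a, b)"
    using less dv[OF S] dv[OF Suc.prems] by (metis add.commute add_le_cancel_left dvd_diff_nat
        dvd_imp_le le_add_diff_inverse less_imp_le zero_less_diff)
  moreover have "Suc (col_length \<mu> b) - a = Suc (Suc (col_length \<mu> b) - Suc a)"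
    using a by simp
  ultimately show ?case by simp
qed

lemma removable_hook_length:
  assumes P: "is_partition \<mu>" and R: "removable \<mu> (x, y)"
  shows "hook_length \<mu> (x, y) = 1"
  using removable_lengths[OF P R] R hook_length_eq[OF P, of x y]
  by (simp add: removable_def row_bead_def col_gap_def)

text \<open>The corner joining the line of \<open>p\<close> to the line of \<open>q\<close> has the
  content difference as its hook length, a multiple of \<open>l\<close>. Since \<open>q\<close> has
  hook length 1, the JM condition makes all hook lengths in the line of \<open>p\<close> divisible,
  and the resulting bound on the corner compares the two ladder indices.\<close>

lemma JM_addable_read_before_removable:
  assumes l: "3 \<le> l" and J: "is_JM_partition l \<mu>"
    and A: "addable \<mu> p" and R: "removable \<mu> q" and res: "residue l p = residue l q"
  shows "read_before l p q"
proof -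
  obtain a b where p: "p = (a, b)" by (cases p)
  obtain x y where q: "q = (x, y)" by (cases q)
  have P: "is_partition \<mu>" using J by (simp add: is_JM_partition_def)
  note a = addable_lengths[OF P A[unfolded p]] and r = removable_lengths[OF P R[unfolded q]]
  have pq: "(a, b) \<notin> \<mu>" "(x, y) \<in> \<mu>" using A R p q by (simp_all add: addable_def removable_def)
  have JM: "\<not> ((c, d) \<in> \<mu> \<and> (c, d') \<in> \<mu> \<and> (c', d) \<in> \<mu> \<and> l dvd hook_length \<mu> (c, d) \<and>
      \<not> l dvd hook_length \<mu> (c, d') \<and> \<not> l dvd hook_length \<mu> (c', d))" for c d c' d'
    using J unfolding is_JM_partition_def by blast
  have q1: "\<not> l dvd hook_length \<mu> (x, y)"
    using removable_hook_length[OF P R[unfolded q]] l by simp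
  have dvd: "int l dvd (int b - int a) - (int y - int x)"
    using res by (simp add: p q residue_def mod_eq_dvd_iff)
  have "ladder_index l p < ladder_index l q \<or>
     ladder_index l p = ladder_index l q \<and> fst p < fst q"
  proof (cases "a < x")
    case True
    have "y < b"
    proof (rule ccontr)
      assume "\<not> y < b"
      then show False using is_partition_down[OF P pq(2), of a b] pq(1) True a by simp
    qed
    then have m: "(a, y) \<in> \<mu>" using a r mem_iff_row_length[OF P] by auto
    have h: "int (hook_length \<mu> (a, y)) = (int b - int a) - (int y - int x)"
      using hook_length_eq[OF P m] a r by (simp add: row_bead_def col_gap_def)
    then have "l dvd hook_length \<mu> (a, y)" using dvd by (metis int_dvd_int_iff)
    \<comment> \<open>The box \<open>q\<close> lies in column \<open>y\<close> of the corner
      \<open>(a, y)\<close> and is not divisible, so row \<open>a\<close> must be entirely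
      divisible.\<close>
    then have "l * (Suc (row_length \<mu> a) - y) \<le> hook_length \<mu> (a, y)"
      using hook_length_row_divisible[OF P _ m] JM[of a y _ x] m pq q1 by blast
    then have "l * (b - y) \<le> hook_length \<mu> (a, y)" using a by simp
    then have "int (l * (b - y)) \<le> (int b - int a) - (int y - int x)"
      unfolding h[symmetric] by (simp only: of_nat_le_iff)
    then have "int l * (int b - int y) \<le> (int b - int a) - (int y - int x)"
      using \<open>y < b\<close> by (simp add: of_nat_diff)
    then have "ladder_index l p \<le> ladder_index l q"
      by (simp add: ladder_index_def p q algebra_simps)
    \<comment> \<open>Both boxes may lie on one ladder here; then \<open>p\<close> is read first
      because it is higher.\<close>
    then show ?thesis using True p q by auto
  next
    case False
    then have "x < a"
    proof -
      have "x \<noteq> a"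
      proof
        assume "x = a"
        \<comment> \<open>In a common row \<open>p\<close> directly follows \<open>q\<close>, so the
          contents differ by 1 and the residues differ.\<close>
        then have "int b - int a - (int y - int x) = 1" using a r by simp
        then show False using dvd l by simp
      qed
      then show ?thesis using False by simp
    qed
    have "b \<le> y"
    proof (rule ccontr)
      assume "\<not> b \<le> y"
      \<comment> \<open>Otherwise the box above \<open>p\<close> would make row \<open>a - 1\<close>
        longer than row \<open>x\<close>, which is not below it.\<close>
      then have "Suc y \<le> row_length \<mu> (a - 1)"
        using addable_iff[OF P, of a b] A p \<open>x < a\<close> r mem_iff_row_length[OF P, of "a - 1" b] by auto
      moreover have "x \<le> a - 1" using \<open>x < a\<close> by linarith
      ultimately show False using row_length_antimono[OF P r(1), of "a - 1"] r(3) by linarith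
    qed
    then have m: "(x, b) \<in> \<mu>" using a r mem_iff_row_length[OF P] by auto
    have h: "int (hook_length \<mu> (x, b)) = (int y - int x) - (int b - int a)"
      using hook_length_eq[OF P m] a r by (simp add: row_bead_def col_gap_def)
    then have "l dvd hook_length \<mu> (x, b)" using dvd by (metis dvd_diff_commute int_dvd_int_iff)
    then have "l * (Suc (col_length \<mu> b) - x) \<le> hook_length \<mu> (x, b)"
      using hook_length_col_divisible[OF P _ m] JM[of x b y] m pq q1 by blast
    then have "l * (a - x) \<le> hook_length \<mu> (x, b)" using a by simp
    then have "int (l * (a - x)) \<le> (int y - int x) - (int b - int a)"
      unfolding h[symmetric] by (simp only: of_nat_le_iff)
    then have ge: "(int l - 1) * (int a - int x) \<le> int y - int b"
      using \<open>x < a\<close> by (simp add: of_nat_diff algebra_simps)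
    \<comment> \<open>With \<open>l - 1\<close> at least 2, applying \<open>ge\<close> inside the
      ladder index gains a factor of at least 4, so the inequality between the indices is
      strict.\<close>
    have "int a - int x < 2 * (2 * (int a - int x))" using \<open>x < a\<close> by simp
    also have "\<dots> \<le> (int l - 1) * ((int l - 1) * (int a - int x))"
      using l \<open>x < a\<close> by (intro mult_mono mult_right_mono) auto
    also have "\<dots> \<le> (int l - 1) * (int y - int b)"
      using ge l by (intro mult_left_mono) auto
    finally show ?thesis by (simp add: ladder_index_def p q algebra_simps)
  qed
  then show ?thesis using read_before_iff[of q l p] r by (simp add: q)
qed

section \<open>Adding the boxes back\<close>

lemma residue_neighbours:
  assumes "2 \<le> l"
  shows "residue l (Suc a, b) \<noteq> residue l (a, b)" "residue l (a, Suc b) \<noteq> residue l (a, b)"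
proof -
  have "\<not> int l dvd 1" using assms by simp
  then show "residue l (Suc a, b) \<noteq> residue l (a, b)" "residue l (a, Suc b) \<noteq> residue l (a, b)"
    by (auto simp: residue_def mod_eq_dvd_iff)
qed

text \<open>Removability depends on the box and on its lower and right neighbours. These have a
  different residue, so \<open>r\<close> is not one of them.\<close>

lemma removable_Diff:
  assumes l: "2 \<le> l" and P: "is_partition \<mu>" and R: "removable \<mu> r"
    and res: "residue l p = residue l r"
  shows "removable (\<mu> - {r}) p \<longleftrightarrow> removable \<mu> p \<and> p \<noteq> r"
proof -
  obtain a b where p: "p = (a, b)" by (cases p)
  have Q: "is_partition (\<mu> - {r})" using R by (simp add: removable_def)
  have "(Suc a, b) \<noteq> r" "(a, Suc b) \<noteq> r" using residue_neighbours[OF l] res p by metis+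
  then show ?thesis using removable_iff[OF P, of a b] removable_iff[OF Q, of a b] p by auto
qed

lemma addable_Diff:
  assumes l: "2 \<le> l" and P: "is_partition \<mu>" and R: "removable \<mu> r"
    and res: "residue l p = residue l r"
  shows "addable (\<mu> - {r}) p \<longleftrightarrow> addable \<mu> p \<or> p = r"
proof (cases "p = r")
  case True
  moreover have "insert r (\<mu> - {r}) = \<mu>" using R by (auto simp: removable_def)
  ultimately show ?thesis using P by (simp add: addable_def)
next
  case False
  obtain a b where p: "p = (a, b)" by (cases p)
  have Q: "is_partition (\<mu> - {r})" using R by (simp add: removable_def)
  \<comment> \<open>The guards ensure that \<open>Suc (a - 1)\<close> is \<open>a\<close> and
    \<open>Suc (b - 1)\<close> is \<open>b\<close> under truncated subtraction.\<close>
  have "1 \<le> a \<Longrightarrow> (a - 1, b) \<noteq> r" "1 \<le> b \<Longrightarrow> (a, b - 1) \<noteq> r"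
    using residue_neighbours(1)[OF l, of "a - 1" b] residue_neighbours(2)[OF l, of a "b - 1"] res p
    by auto
  then show ?thesis
    using addable_iff[OF P, of a b] addable_iff[OF Q, of a b] p False by auto
qed

text \<open>By \<open>sep\<close> no minus precedes a plus, so the signature is already reduced, and
  \<open>last\<close> makes \<open>r\<close> its rightmost plus.\<close>

lemma f_hat_eqI:
  assumes l: "2 \<le> l" and P: "is_partition \<mu>"
    and sep: "\<And>p q. addable \<mu> p \<Longrightarrow> removable \<mu> q \<Longrightarrow> residue l p = i \<Longrightarrow> residue l q = i \<Longrightarrow>
      read_before l p q"
    and r: "addable \<mu> r" "residue l r = i"
    and last: "\<And>p. addable \<mu> p \<Longrightarrow> residue l p = i \<Longrightarrow> p \<noteq> r \<Longrightarrow> read_before l p r"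
  shows "f_hat l i \<mu> = Some (insert r \<mu>)"
proof -
  let ?R = "\<lambda>x y. read_before l (snd x) (snd y)"
  define w where "w = ladder_signature l i \<mu>"
  have w: "set w = signature_letters l i \<mu>" "sorted_wrt ?R w"
    using theI'[OF ladder_signature_ex1[OF P l, of i]] unfolding w_def ladder_signature_def by blast+
  have pos: "1 \<le> fst p \<and> 1 \<le> snd p" if "addable \<mu> p \<or> removable \<mu> p" for p
    using that is_partition_pos[of "insert p \<mu>" p] is_partition_pos[OF P, of p]
    by (auto simp: addable_def removable_def)
  have rb: "read_before l p q \<longleftrightarrow>
      ladder_index l p < ladder_index l q \<or> ladder_index l p = ladder_index l q \<and> fst p < fst q"
    if "addable \<mu> q \<or> removable \<mu> q" for p q
    using pos[OF that] by (intro read_before_iff) simp_all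
  have asym: "\<not> (read_before l p q \<and> read_before l q p)"
    if "addable \<mu> p \<or> removable \<mu> p" "addable \<mu> q \<or> removable \<mu> q" for p q
    unfolding rb[OF that(1)] rb[OF that(2)] by auto
  have Plus: "addable \<mu> p \<and> residue l p = i" if "(Plus, p) \<in> set w" for p
    using that w(1) by (auto simp: signature_letters_def)
  have Minus: "removable \<mu> p \<and> residue l p = i" if "(Minus, p) \<in> set w" for p
    using that w(1) by (auto simp: signature_letters_def)
  have "\<not> (\<exists>w'. cancel w w')"
  proof
    assume "\<exists>w'. cancel w w'"
    then obtain u v p q where uv: "w = u @ (Minus, p) # (Plus, q) # v" by (auto elim: cancel.cases)
    then have "read_before l p q" using w(2) by (simp add: sorted_wrt_append)
    moreover have "addable \<mu> q \<and> residue l q = i" "removable \<mu> p \<and> residue l p = i"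
      using Plus Minus uv by simp_all
    ultimately show False using asym sep by blast
  qed
  then have red: "reduced_signature w = w"
    by (simp add: reduced_signature_eq_foldr foldr_push_irreducible)
  define ps where "ps = filter (\<lambda>x. fst x = Plus) w"
  have "(Plus, r) \<in> set w" using r unfolding w(1) signature_letters_def by blast
  then have r_in: "(Plus, r) \<in> set ps" by (simp add: ps_def)
  then have ne: "ps \<noteq> []" by auto
  then obtain us x where us: "ps = us @ [x]" by (metis rev_exhaust)
  have "snd x = r"
  proof (rule ccontr)
    assume neq: "snd x \<noteq> r"
    have "x \<in> set ps" using us by simp
    then have x: "addable \<mu> (snd x)" "residue l (snd x) = i"
      using Plus[of "snd x"] by (auto simp: ps_def) (metis prod.collapse)+
    have "sorted_wrt ?R ps" using w(2) by (simp add: ps_def sorted_wrt_filter)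
    moreover have "(Plus, r) \<in> set us" using r_in us neq by auto
    ultimately have "read_before l r (snd x)" using us by (auto simp: sorted_wrt_append)
    then show False using last[OF x neq] asym x r by blast
  qed
  then show ?thesis
    using ne us by (simp add: f_hat_def w_def[symmetric] red ps_def[symmetric] Let_def)
qed

text \<open>Removing the first removable \<open>i\<close>-box in reading order keeps the signature
  separated and turns that box into its last plus, so \<open>f_hat\<close> restores it.\<close>

lemma ladder_crystal_if_remove_all:
  assumes l: "2 \<le> l" and i: "0 \<le> i" "i < int l" and P: "is_partition \<mu>"
    and sep: "\<And>p q. addable \<mu> p \<Longrightarrow> removable \<mu> q \<Longrightarrow> residue l p = i \<Longrightarrow> residue l q = i \<Longrightarrow>
      read_before l p q"
    and crystal: "remove_all l i \<mu> \<in> ladder_crystal l"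
  shows "\<mu> \<in> ladder_crystal l"
  using P sep crystal
proof (induction "card \<mu>" arbitrary: \<mu> rule: less_induct)
  case less
  note P = less.prems(1) and sep = less.prems(2)
  define S where "S = {p. removable \<mu> p \<and> residue l p = i}"
  show ?case
  proof (cases "S = {}")
    case True
    moreover have "remove_all l i \<mu> = \<mu> - S" by (simp add: remove_all_def S_def)
    ultimately show ?thesis using less.prems(3) by simp
  next
    case False
    \<comment> \<open>The first minus of the ladder signature.\<close>
    obtain r where r: "r \<in> S" "\<And>p. p \<in> S \<Longrightarrow> p \<noteq> r \<Longrightarrow> read_before l r p"
    proof -
      obtain w where w: "set w = signature_letters l i \<mu>"
        "sorted_wrt (\<lambda>x y. read_before l (snd x) (snd y)) w"
        using ladder_signature_ex1[OF P l] by blast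
      define v where "v = filter (\<lambda>x. fst x = Minus) w"
      have v: "set v = Pair Minus ` S" "sorted_wrt (\<lambda>x y. read_before l (snd x) (snd y)) v"
        using w by (auto simp: v_def S_def signature_letters_def sorted_wrt_filter)
      then have "v \<noteq> []" using False by auto
      moreover have "fst (hd v) = Minus" if "v \<noteq> []" using hd_in_set[OF that] v(1) by auto
      ultimately obtain r v' where v': "v = (Minus, r) # v'"
        by (metis list.collapse prod.collapse)
      show ?thesis
      proof (rule that)
        show "r \<in> S" using v(1) v' by auto
        show "read_before l r p" if "p \<in> S" "p \<noteq> r" for p
        proof -
          have "(Minus, p) \<in> set v" using v(1) that(1) by blast
          then have "(Minus, p) \<in> set v'" using v' that(2) by simp
          then show ?thesis using v(2) v' by auto
        qed
      qed
    qed
    define \<nu> where "\<nu> = \<mu> - {r}"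
    have rr: "removable \<mu> r" "residue l r = i" using r by (simp_all add: S_def)
    have \<mu>: "\<mu> = insert r \<nu>" using rr by (auto simp: \<nu>_def removable_def)
    have Q: "is_partition \<nu>" using rr by (simp add: removable_def \<nu>_def)
    have rem: "removable \<nu> p \<longleftrightarrow> removable \<mu> p \<and> p \<noteq> r" if "residue l p = i" for p
      using removable_Diff[OF l P rr(1)] that rr by (simp add: \<nu>_def)
    have add: "addable \<nu> p \<longleftrightarrow> addable \<mu> p \<or> p = r" if "residue l p = i" for p
      using addable_Diff[OF l P rr(1)] that rr by (simp add: \<nu>_def)
    \<comment> \<open>The only new addable \<open>i\<close>-box is \<open>r\<close>, which precedes
      the remaining removable ones by its choice.\<close>
    have sep': "read_before l p q"
      if "addable \<nu> p" "removable \<nu> q" "residue l p = i" "residue l q = i" for p q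
      using that rem add sep[of p q] r(2)[of q] by (auto simp: S_def)
    have "remove_all l i \<nu> = remove_all l i \<mu>"
      using rem rr unfolding remove_all_def \<nu>_def by blast
    then have "remove_all l i \<nu> \<in> ladder_crystal l" using less.prems(3) by simp
    moreover have "card \<nu> < card \<mu>"
      using rr is_partition_finite[OF P] unfolding \<nu>_def removable_def
      by (simp add: card_Diff1_less del: card_Diff_insert)
    ultimately have "\<nu> \<in> ladder_crystal l" using less.hyps Q sep' by blast
    \<comment> \<open>All other addable \<open>i\<close>-boxes precede \<open>r\<close> by
      \<open>sep\<close>, since \<open>r\<close> was removable in \<open>\<mu>\<close>.\<close>
    moreover have "f_hat l i \<nu> = Some (insert r \<nu>)"
      using add rr sep by (intro f_hat_eqI[OF l Q sep']) auto
    ultimately show ?thesis using ladder_crystal.step[OF _ i] \<mu> by simp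
  qed
qed

theorem theorem3p7p4p1:
  fixes l :: nat and \<mu> :: "position set"
  assumes "3 \<le> l"
    and "is_JM_partition l \<mu>"
  shows "\<mu> \<in> ladder_crystal l"
  using assms(2)
proof (induction "card \<mu>" arbitrary: \<mu> rule: less_induct)
  case less
  have l: "2 \<le> l" using assms(1) by simp
  have P: "is_partition \<mu>" using less.prems by (simp add: is_JM_partition_def)
  show ?case
  proof (cases "\<mu> = {}")
    case True
    then show ?thesis using ladder_crystal.empty by simp
  next
    case False
    then obtain r where r: "removable \<mu> r" using ex_removable[OF P] by blast
    \<comment> \<open>The residue of an existing removable box, so that \<open>remove_all\<close>
      strictly shrinks the diagram and the induction applies.\<close>
    define i where "i = residue l r"
    have i: "0 \<le> i" "i < int l" using assms(1) by (auto simp: i_def residue_def split: prod.splits)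
    have "card (remove_all l i \<mu>) < card \<mu>"
      using r is_partition_finite[OF P]
      by (intro psubset_card_mono) (auto simp: remove_all_def i_def removable_def)
    then have "remove_all l i \<mu> \<in> ladder_crystal l"
      using less.hyps is_JM_partition_remove_all[OF l less.prems] by blast
    then show ?thesis
      using JM_addable_read_before_removable[OF assms(1) less.prems]
      by (intro ladder_crystal_if_remove_all[OF l i P]) auto
  qed
qed

end
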